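(* Let $\Sigma$ be a finite alphabet with at least two letters. Let $R\subseteq\Sigma^*$ be a language accepted by a DFA $M$ over $\Sigma$ with $n$ states, and let $L\subseteq\Sigma^*$ be an arbitrary language. Then there exists a DFA with at most $2^{n+1}-1$ states that accepts $L\backslash R^*$, where $L\backslash R^*$ means the left quotient of $R^*$ by $L$.
   Context: A DFA is a tuple $(Q,\Sigma,\delta,s,F)$ with $Q$ a finite nonempty set of states, $\Sigma$ a finite nonempty input alphabet, $\delta:Q\times\Sigma\to Q$ the transition function, $s\in Q$ the initial state and $F\subseteq Q$ the set of final states. All DFAs are complete, i.e. $\delta$ is a total function. For languages $L,K\subseteq\Sigma^*$, the left quotient of $K$ by $L$ is $L\backslash K=\{y\mid xy\in K\text{ for some }x\in L\}$. For a language $R$, $R^*$ denotes its Kleene star. *)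

theory Defs
  imports Main
begin

record ('q, 'a) dfa =
  states :: "'q set"
  alphabet :: "'a set"
  trans :: "'q \<Rightarrow> 'a \<Rightarrow> 'q"
  init :: "'q"
  final :: "'q set"

(* Values of trans outside states \<times> alphabet are unconstrained and irrelevant;
   completeness is the last conjunct. *)
definition is_dfa :: "('q, 'a) dfa \<Rightarrow> bool" where
  "is_dfa M \<longleftrightarrow>
     finite (states M) \<and> states M \<noteq> {} \<and>
     finite (alphabet M) \<and> alphabet M \<noteq> {} \<and>
     init M \<in> states M \<and>
     final M \<subseteq> states M \<and>
     (\<forall>q\<in>states M. \<forall>a\<in>alphabet M. trans M q a \<in> states M)"

definition run :: "('q, 'a) dfa \<Rightarrow> 'q \<Rightarrow> 'a list \<Rightarrow> 'q" where
  "run M q w = foldl (trans M) q w"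

definition language :: "('q, 'a) dfa \<Rightarrow> 'a list set" where
  "language M = {w \<in> lists (alphabet M). run M (init M) w \<in> final M}"

definition kleene_star :: "'a list set \<Rightarrow> 'a list set" where
  "kleene_star R = {concat ws |ws. ws \<in> lists R}"

definition left_quotient :: "'a list set \<Rightarrow> 'a list set \<Rightarrow> 'a list set" where
  "left_quotient L K = {y. \<exists>x\<in>L. x @ y \<in> K}"

end

theory Submission
  imports Defs
begin

text \<open>The residual of \<open>L \ R\<^sup>*\<close> by a word \<open>w\<close> is \<open>Lw \ R\<^sup>*\<close>. If \<open>w\<close> is nonempty, every word of \<open>Lw\<close>
  is nonempty, and then \<open>Lw \ R\<^sup>*\<close> depends only on the set of states in which \<open>M\<close> can be
  while reading an unfinished (or just finished) factor from \<open>R\<close> at the end of a word of \<open>Lw\<close>.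
  So there are at most \<open>2 ^ n\<close> residuals by nonempty words and at most \<open>2 ^ n + 1\<close> in total,
  which is at most \<open>2 ^ (n + 1) - 1\<close> because \<open>n \<ge> 1\<close>; the residuals are the states
  of the minimal automaton.\<close>

abbreviation residual :: "'a list set \<Rightarrow> 'a list \<Rightarrow> 'a list set" where
  "residual K w \<equiv> left_quotient {w} K"

lemma residual_append: "residual (residual K u) v = residual K (u @ v)"
  by (simp add: left_quotient_def)

lemma residual_Nil: "residual K [] = K"
  by (simp add: left_quotient_def)

lemma Nil_in_residual: "[] \<in> residual K w \<longleftrightarrow> w \<in> K"
  by (simp add: left_quotient_def)

text \<open>Reading \<open>w\<close> changes only the dividing language, so a fact about quotients
  of \<open>K\<close> by other languages applies to the residuals too.\<close>

lemma residual_left_quotient: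
  "residual (left_quotient L K) w = left_quotient ((\<lambda>x. x @ w) ` L) K"
  by (simp add: left_quotient_def)

text \<open>The Myhill-Nerode construction: reading \<open>a\<close> in the state \<open>X\<close>
  leads to \<open>residual X [a]\<close>, and \<open>X\<close> is accepting iff
  \<open>[] \<in> X\<close>.\<close>

lemma dfa_of_finite_residuals:
  fixes K :: "'a list set"
  assumes "finite \<Sigma>" and "\<Sigma> \<noteq> {}" and K: "K \<subseteq> lists \<Sigma>"
    and fin: "finite (residual K ` lists \<Sigma>)"
  shows "\<exists>N :: (nat, 'a) dfa. is_dfa N \<and> alphabet N = \<Sigma> \<and>
           card (states N) = card (residual K ` lists \<Sigma>) \<and> language N = K"
proof -
  let ?D = "residual K ` lists \<Sigma>"
  obtain g :: "'a list set \<Rightarrow> nat" where g: "inj_on g ?D"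
    using finite_imp_inj_to_nat_seg[OF fin] by blast
  \<comment> \<open>States are codes of residuals, which keeps the state type \<open>nat\<close>;
    \<open>inv_into ?D g\<close> decodes them.\<close>
  define N where "N = \<lparr>states = g ` ?D, alphabet = \<Sigma>,
    trans = (\<lambda>i a. g (residual (inv_into ?D g i) [a])), init = g K,
    final = g ` {X \<in> ?D. [] \<in> X}\<rparr>"
  have trans: "trans N (g (residual K w)) a = g (residual K (w @ [a]))" if "w \<in> lists \<Sigma>" for w a
    using that by (simp add: N_def inv_into_f_f[OF g] residual_append del: in_lists_conv_set)
  have run: "run N (g K) w = g (residual K w)" if "w \<in> lists \<Sigma>" for w
    using that
    by (induction w rule: rev_induct) (auto simp: run_def residual_Nil trans)
  have init: "K \<in> ?D"
    by (rule image_eqI[where x = "[]"]) (auto simp: residual_Nil)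
  have final: "g (residual K w) \<in> final N \<longleftrightarrow> w \<in> K" if w: "w \<in> lists \<Sigma>" for w
  proof -
    \<comment> \<open>Injectivity on \<open>?D\<close> prevents a rejecting residual from sharing
      its code with an accepting one.\<close>
    have "g (residual K w) \<in> final N \<longleftrightarrow> residual K w \<in> {X \<in> ?D. [] \<in> X}"
      unfolding N_def dfa.simps using w by (intro inj_on_image_mem_iff[OF g]) blast+
    then show ?thesis
      using w by (simp add: Nil_in_residual del: in_lists_conv_set)
  qed
  have closed: "trans N q a \<in> states N" if q: "q \<in> states N" and a: "a \<in> \<Sigma>" for q a
  proof -
    obtain w where w: "w \<in> lists \<Sigma>" "q = g (residual K w)"
      using q by (auto simp: N_def)
    moreover have "w @ [a] \<in> lists \<Sigma>"
      using w a by simp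
    ultimately show ?thesis
      unfolding w(2) trans[OF w(1)] by (simp add: N_def del: in_lists_conv_set)
  qed
  have "is_dfa N"
    unfolding is_dfa_def
    using closed init assms by (auto simp: N_def)
  moreover have "language N = K"
  proof -
    have "alphabet N = \<Sigma>" "init N = g K"
      by (simp_all add: N_def)
    then have "w \<in> language N \<longleftrightarrow> w \<in> lists \<Sigma> \<and> w \<in> K" for w
      using run[of w] final[of w] unfolding language_def mem_Collect_eq by metis
    then show ?thesis using K by blast
  qed
  moreover have "card (states N) = card ?D"
    by (simp add: N_def card_image[OF g])
  ultimately show ?thesis
    by (intro exI[of _ N]) (simp add: N_def)
qed

lemma kleene_star_Nil: "[] \<in> kleene_star R"
  by (auto simp: kleene_star_def intro: exI[of _ "[]"])

lemma kleene_star_Cons: "w \<in> R \<Longrightarrow> x \<in> kleene_star R \<Longrightarrow> w @ x \<in> kleene_star R"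
  unfolding kleene_star_def mem_Collect_eq by (metis concat.simps(2) lists.Cons)

lemma kleene_star_append:
  "x \<in> kleene_star R \<Longrightarrow> y \<in> kleene_star R \<Longrightarrow> x @ y \<in> kleene_star R"
  unfolding kleene_star_def mem_Collect_eq by (metis concat_append append_in_lists_conv)

lemma kleene_star_subset_lists: "R \<subseteq> lists \<Sigma> \<Longrightarrow> kleene_star R \<subseteq> lists \<Sigma>"
  by (fastforce simp: kleene_star_def)

text \<open>The end of \<open>x\<close> falls inside or at the end of some factor, which becomes
  \<open>v @ y1\<close>. If \<open>x\<close> and \<open>y\<close> were both empty and
  \<open>[] \<notin> R\<close>, no such factor would exist.\<close>

lemma kleene_star_split:
  assumes "x @ y \<in> kleene_star R" and "x \<noteq> []"
  shows "\<exists>u v y1 y2. x = u @ v \<and> y = y1 @ y2 \<and>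
           u \<in> kleene_star R \<and> v @ y1 \<in> R \<and> y2 \<in> kleene_star R"
proof -
  obtain ws where "ws \<in> lists R" "x @ y = concat ws"
    using assms(1) by (auto simp: kleene_star_def)
  then show ?thesis
    using assms(2)
  proof (induction ws arbitrary: x)
    case Nil
    then show ?case by simp
  next
    case (Cons w ws)
    have w: "w \<in> R" and ws: "concat ws \<in> kleene_star R"
      using Cons.hyps by (auto simp: kleene_star_def)
    from Cons.prems(1) obtain z where
      "w = x @ z \<and> y = z @ concat ws \<or> x = w @ z \<and> z @ y = concat ws"
      by (auto simp: append_eq_append_conv2)
    \<comment> \<open>The case where \<open>x\<close> ends exactly with \<open>w\<close> is split
      off, so that in the last case \<open>z\<close> is nonempty, as the induction hypothesis
      demands.\<close>
    then consider "w = x @ z" "y = z @ concat ws"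
      | "x = w" "y = concat ws"
      | "x = w @ z" "z @ y = concat ws" "z \<noteq> []"
      by fastforce
    then show ?case
    proof cases
      case 1
      then show ?thesis
        using w ws kleene_star_Nil by (metis append_Nil)
    next
      case 2
      then show ?thesis
        using w ws kleene_star_Nil by (metis append_Nil append_Nil2)
    next
      case 3
      with Cons.IH obtain u v y1 y2 where
        "z = u @ v" "y = y1 @ y2" "u \<in> kleene_star R" "v @ y1 \<in> R" "y2 \<in> kleene_star R"
        by blast
      then show ?thesis
        using w 3(1) kleene_star_Cons by (metis append_assoc)
    qed
  qed
qed

lemma run_append: "run M q (u @ v) = run M (run M q u) v"
  by (simp add: run_def)

lemma run_in_states:
  "is_dfa M \<Longrightarrow> q \<in> states M \<Longrightarrow> w \<in> lists (alphabet M) \<Longrightarrow> run M q w \<in> states M"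
  by (induction w arbitrary: q) (auto simp: run_def is_dfa_def)

text \<open>The possible continuations when a factor is pending and \<open>M\<close> may be in any
  state of \<open>T\<close>. Of the pending word only the state reached matters, which bounds the
  number of these languages by the number of subsets.\<close>

definition star_from :: "('q, 'a) dfa \<Rightarrow> 'q set \<Rightarrow> 'a list set" where
  "star_from M T = {y1 @ y2 |y1 y2. y1 \<in> lists (alphabet M) \<and>
     (\<exists>q\<in>T. run M q y1 \<in> final M) \<and> y2 \<in> kleene_star (language M)}"

text \<open>The empty word must be excluded from \<open>L\<close>: it puts \<open>[]\<close> into the quotient even
  when the initial state of \<open>M\<close> is not final.\<close>

lemma left_quotient_star_eq_star_from:
  assumes M: "is_dfa M" and L: "L \<subseteq> lists (alphabet M)" and Nil: "[] \<notin> L"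
  shows "\<exists>T\<subseteq>states M. left_quotient L (kleene_star (language M)) = star_from M T"
proof -
  let ?R = "language M"
  \<comment> \<open>Here \<open>u\<close> consists of finished factors and \<open>v\<close> is the
    pending one. Allowing \<open>v = []\<close> is sound: a fresh factor then starts right after
    \<open>u\<close>.\<close>
  define T where "T = {run M (init M) v |u v. u \<in> kleene_star ?R \<and> u @ v \<in> L}"
  have "T \<subseteq> states M"
    using M L by (fastforce simp: T_def is_dfa_def intro: run_in_states[OF M])
  moreover have "left_quotient L (kleene_star ?R) = star_from M T"
  proof (intro equalityI subsetI)
    fix y assume "y \<in> left_quotient L (kleene_star ?R)"
    then obtain x where x: "x \<in> L" "x @ y \<in> kleene_star ?R"
      by (auto simp: left_quotient_def)
    with Nil have "x \<noteq> []" by blast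
    from kleene_star_split[OF x(2) this] obtain u v y1 y2 where
      *: "x = u @ v" "y = y1 @ y2" "u \<in> kleene_star ?R" "v @ y1 \<in> ?R" "y2 \<in> kleene_star ?R"
      by blast
    have "run M (init M) v \<in> T"
      using * x(1) by (auto simp: T_def)
    moreover have "y1 \<in> lists (alphabet M)" "run M (run M (init M) v) y1 \<in> final M"
      using *(4) by (auto simp: language_def run_append)
    ultimately show "y \<in> star_from M T"
      using * by (auto simp: star_from_def)
  next
    fix y assume "y \<in> star_from M T"
    then obtain y1 y2 u v where *: "y = y1 @ y2" "y1 \<in> lists (alphabet M)"
      "y2 \<in> kleene_star ?R" "u \<in> kleene_star ?R" "u @ v \<in> L"
      "run M (run M (init M) v) y1 \<in> final M"
      by (auto simp: star_from_def T_def)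
    then have "v @ y1 \<in> ?R"
      using L by (auto simp: language_def run_append)
    then have "u @ (v @ y1) @ y2 \<in> kleene_star ?R"
      using * by (intro kleene_star_append kleene_star_Cons)
    then show "y \<in> left_quotient L (kleene_star ?R)"
      using * by (auto simp: left_quotient_def intro!: bexI[of _ "u @ v"])
  qed
  ultimately show ?thesis by blast
qed

theorem theorem3:
  fixes \<Sigma> :: "'a set"
    and M :: "('q, 'a) dfa"
    and R L :: "'a list set"
    and n :: nat
  assumes "finite \<Sigma>" and "card \<Sigma> \<ge> 2"
    and "R \<subseteq> lists \<Sigma>"
    and "is_dfa M" and "alphabet M = \<Sigma>" and "card (states M) = n" and "language M = R"
    and "L \<subseteq> lists \<Sigma>"
  shows "\<exists>N :: (nat, 'a) dfa.
           is_dfa N \<and> alphabet N = \<Sigma> \<and> card (states N) \<le> 2 ^ (n + 1) - 1 \<and>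
           language N = left_quotient L (kleene_star R)"
proof -
  let ?K = "left_quotient L (kleene_star R)"
  \<comment> \<open>The extra element \<open>?K\<close> is the residual by \<open>[]\<close>, the
    only one whose dividing language may contain \<open>[]\<close>.\<close>
  let ?B = "insert ?K (star_from M ` Pow (states M))"
  have finQ: "finite (states M)" and "states M \<noteq> {}"
    using assms(4) by (auto simp: is_dfa_def)
  then have n: "n \<ge> 1"
    using assms(6) by (metis One_nat_def Suc_leI card_gt_0_iff)
  have "residual ?K w \<in> ?B" if w: "w \<in> lists \<Sigma>" for w
  proof (cases "w = []")
    case True
    then show ?thesis by (simp add: residual_Nil)
  next
    case False
    have "(\<lambda>x. x @ w) ` L \<subseteq> lists (alphabet M)"
      using w assms(5,8) by fastforce
    moreover have "[] \<notin> (\<lambda>x. x @ w) ` L"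
      using False by auto
    ultimately have "\<exists>T\<subseteq>states M. residual ?K w = star_from M T"
      unfolding residual_left_quotient assms(7)[symmetric]
      by (rule left_quotient_star_eq_star_from[OF assms(4)])
    then show ?thesis by blast
  qed
  then have sub: "residual ?K ` lists \<Sigma> \<subseteq> ?B"
    by blast
  have finB: "finite ?B"
    using finQ by simp
  have "card ?B \<le> Suc (card (star_from M ` Pow (states M)))"
    by (rule card_insert_le_m1) auto
  also have "\<dots> \<le> Suc (2 ^ n)"
    using card_image_le[of "Pow (states M)" "star_from M"] finQ assms(6) by (simp add: card_Pow)
  \<comment> \<open>This amounts to \<open>2 \<le> 2 ^ n\<close>, with equality for
    \<open>n = 1\<close>.\<close>
  also have "\<dots> \<le> 2 ^ (n + 1) - 1"
    using power_increasing[OF n, of "2::nat"] by simp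
  finally have "card (residual ?K ` lists \<Sigma>) \<le> 2 ^ (n + 1) - 1"
    using card_mono[OF finB sub] by linarith
  moreover have "?K \<subseteq> lists \<Sigma>"
    using kleene_star_subset_lists[OF assms(3)] by (fastforce simp: left_quotient_def)
  moreover have "\<Sigma> \<noteq> {}"
    using assms(2) by auto
  ultimately show ?thesis
    using dfa_of_finite_residuals[OF assms(1), of ?K] finite_subset[OF sub finB] by metis
qed

end
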